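(* Let $G$ be a finite simple graph on $n\geq 2$ vertices with no isolated vertices. Then \[ \sum_{e\in E(G)} \frac{1}{\mathrm{cl}(e) - 1} \geq \frac{n}{2} \qquad\text{and}\qquad \sum_{e\in E(G)} \frac{1}{\mathrm{cl}(e)} \geq \frac{n-c(G)}{2}, \] where $c(G)$ is the number of connected components of $G$.
   Context: For an edge $e$ of $G$, $\mathrm{cl}(e)$ denotes the order of the largest clique of $G$ containing $e$. *)

theory Defs
  imports Complex_Main "Graph_Theory.Graph_Theory"
begin

text \<open>
  Finite simple graphs are the locale \<open>graph\<close> of \<open>Graph_Theory\<close>: finite, loop-free, symmetric
  digraphs without parallel arcs.  There an undirected edge is a pair of opposite arcs, so sums
  over the edges of the graph must range over unordered pairs of endpoints, not over arcs.
\<close>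

definition edges :: "('a, 'b) pre_digraph \<Rightarrow> 'a set set" where
  "edges G = {{u, v} | u v. u \<rightarrow>\<^bsub>G\<^esub> v}"

definition isolated :: "('a, 'b) pre_digraph \<Rightarrow> 'a \<Rightarrow> bool" where
  "isolated G v \<longleftrightarrow> v \<in> verts G \<and> \<not> (\<exists>e \<in> edges G. v \<in> e)"

definition clique :: "('a, 'b) pre_digraph \<Rightarrow> 'a set \<Rightarrow> bool" where
  "clique G K \<longleftrightarrow> K \<subseteq> verts G \<and> (\<forall>u \<in> K. \<forall>v \<in> K. u \<noteq> v \<longrightarrow> u \<rightarrow>\<^bsub>G\<^esub> v)"

text \<open>For an edge \<open>e\<close> of a finite graph the maximum is over a finite nonempty set, since
  \<open>e\<close> itself is a clique; in particular it is at least 2.\<close>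

definition cl :: "('a, 'b) pre_digraph \<Rightarrow> 'a set \<Rightarrow> nat" where
  "cl G e = Max {card K | K. clique G K \<and> e \<subseteq> K}"

text \<open>Connected components are the maximal connected subgraphs; \<open>connected\<close> excludes the
  graph without vertices.\<close>

definition num_components :: "('a, 'b) pre_digraph \<Rightarrow> nat" where
  "num_components G = card {H. pre_digraph.max_subgraph G connected H}"

end

theory Submission
  imports Defs
begin

text \<open>
  For the first inequality, \<open>cl G {u, v} - 1\<close> is at most the degree of \<open>u\<close>, so the edges at
  each vertex contribute at least 1, and every edge is counted at two vertices.

  For the second, start from the partition of the vertices into singletons, process the cliques
  in order of decreasing size and merge all parts that meet the current clique.  If a clique
  \<open>K\<close> meets \<open>k\<close> parts, at most \<open>k - 1\<close> parts are lost.  Each vertex of \<open>K\<close> is joined within \<open>K\<close>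
  to at least \<open>k - 1\<close> vertices of other parts, so at least \<open>card K * (k - 1) / 2\<close> edges of \<open>K\<close>
  run between different parts.  None of them lies in an earlier clique, so each has
  \<open>cl G e = card K\<close>, and together they contribute at least \<open>(k - 1) / 2\<close>.  In the end every part
  is a union of components.
\<close>

section \<open>Merging labels along a family of finite blocks\<close>

definition max_block :: "'a set set \<Rightarrow> 'a \<times> 'a \<Rightarrow> nat" where
  "max_block S z = Max {card K | K. K \<in> S \<and> {fst z, snd z} \<subseteq> K}"

text \<open>Pairs are ordered: for the family of all cliques this set is \<open>arcs_ends G\<close>
  and \<open>max_block\<close> becomes \<open>cl\<close>, so each edge occurs twice and no factor
  1/2 is needed.\<close>

definition block_pairs :: "'a set set \<Rightarrow> ('a \<times> 'a) set" where
  "block_pairs S = {(x, y). x \<noteq> y \<and> (\<exists>K\<in>S. {x, y} \<subseteq> K)}"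

lemma block_pairs_subset:
  assumes "\<And>K. K \<in> S \<Longrightarrow> K \<subseteq> V"
  shows "block_pairs S \<subseteq> V \<times> V"
  using assms by (fastforce simp: block_pairs_def)

text \<open>Such a pair already lies in a block of \<open>S\<close>, and \<open>K\<close> is no
  larger than that block, so \<open>K\<close> cannot raise the maximum.\<close>

lemma max_block_insert_old:
  assumes "finite S" and "\<And>L. L \<in> S \<Longrightarrow> card K \<le> card L" and "z \<in> block_pairs S"
  shows "max_block (insert K S) z = max_block S z"
proof -
  let ?A = "{card L | L. L \<in> S \<and> {fst z, snd z} \<subseteq> L}"
  have fin: "finite ?A" using assms(1) by simp
  obtain L where L: "L \<in> S" "{fst z, snd z} \<subseteq> L"
    using assms(3) by (auto simp: block_pairs_def)
  show ?thesis
  proof (cases "{fst z, snd z} \<subseteq> K")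
    case True
    have "card K \<le> card L" using assms(2) L(1) .
    also have "card L \<le> Max ?A" using L fin by (intro Max_ge) auto
    finally have "Max (insert (card K) ?A) = Max ?A"
      using fin L by (subst Max_insert) auto
    moreover have "{card M | M. M \<in> insert K S \<and> {fst z, snd z} \<subseteq> M} = insert (card K) ?A"
      using True by auto
    ultimately show ?thesis by (simp add: max_block_def)
  next
    case False
    then have "{card M | M. M \<in> insert K S \<and> {fst z, snd z} \<subseteq> M} = ?A" by auto
    then show ?thesis by (simp add: max_block_def)
  qed
qed

lemma max_block_insert_new:
  assumes "z \<in> K \<times> K" and "fst z \<noteq> snd z" and "z \<notin> block_pairs S"
  shows "max_block (insert K S) z = card K"
proof -
  have "{card M | M. M \<in> insert K S \<and> {fst z, snd z} \<subseteq> M} = {card K}"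
    using assms by (cases z) (auto simp: block_pairs_def)
  then show ?thesis by (simp add: max_block_def)
qed

lemma card_separated_pairs:
  assumes "finite K"
  shows "card K * (card (p ` K) - 1) \<le> card {(x, y). x \<in> K \<and> y \<in> K \<and> p x \<noteq> p y}"
proof -
  have "card (p ` K) - 1 \<le> card {y \<in> K. p x \<noteq> p y}" if "x \<in> K" for x
  proof -
    have "card (p ` K) - 1 = card (p ` K - {p x})" using that assms by simp
    also have "p ` K - {p x} = p ` {y \<in> K. p x \<noteq> p y}" by auto
    also have "card \<dots> \<le> card {y \<in> K. p x \<noteq> p y}" using assms by (intro card_image_le) auto
    finally show ?thesis .
  qed
  then have "card K * (card (p ` K) - 1) \<le> (\<Sum>x\<in>K. card {y \<in> K. p x \<noteq> p y})"
    using sum_mono[of K "\<lambda>_. card (p ` K) - 1"] by simp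
  also have "\<dots> = card (SIGMA x:K. {y \<in> K. p x \<noteq> p y})" using assms by simp
  also have "(SIGMA x:K. {y \<in> K. p x \<noteq> p y}) = {(x, y). x \<in> K \<and> y \<in> K \<and> p x \<noteq> p y}" by auto
  finally show ?thesis .
qed

text \<open>All labels occurring on \<open>K\<close> collapse to the label of one point of
  \<open>K\<close>. That \<open>q\<close> is coarser than \<open>p\<close> keeps earlier blocks
  monochromatic.\<close>

lemma merge_labels:
  fixes p :: "'a \<Rightarrow> 'b"
  assumes "finite V" and "K \<subseteq> V"
  obtains q :: "'a \<Rightarrow> 'b" where "\<And>x y. x \<in> K \<Longrightarrow> y \<in> K \<Longrightarrow> q x = q y"
    and "\<And>x y. p x = p y \<Longrightarrow> q x = q y"
    and "card (p ` V) \<le> card (q ` V) + (card (p ` K) - 1)"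
proof (cases "K = {}")
  case True
  then show ?thesis using that[of p] by simp
next
  case False
  then obtain z where z: "z \<in> K" by auto
  define q where "q x = (if p x \<in> p ` K then p z else p x)" for x
  have fin: "finite (p ` K)" using assms finite_subset by blast
  \<comment> \<open>The labels not met by \<open>K\<close>, and the common new label,
    survive.\<close>
  have "insert (p z) (p ` V - p ` K) \<subseteq> q ` V"
    using z assms(2) by (auto simp: q_def image_iff)
  then have "card (insert (p z) (p ` V - p ` K)) \<le> card (q ` V)"
    using assms(1) by (intro card_mono) auto
  moreover have "card (insert (p z) (p ` V - p ` K)) = Suc (card (p ` V - p ` K))"
    using assms(1) z by (intro card_insert_disjoint) auto
  moreover have "card (p ` V) - card (p ` K) \<le> card (p ` V - p ` K)"
    using fin by (rule diff_card_le_card_Diff)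
  moreover have "card (p ` K) \<noteq> 0" using fin False by simp
  ultimately have bound: "card (p ` V) \<le> card (q ` V) + (card (p ` K) - 1)" by linarith
  show ?thesis
  proof (rule that)
    show "q x = q y" if "x \<in> K" "y \<in> K" for x y using that by (simp add: q_def)
    show "q x = q y" if "p x = p y" for x y using that by (simp add: q_def)
  qed (rule bound)
qed

text \<open>The labels encode the current partition of \<open>V\<close>; the weights of the pairs
  seen so far pay for the labels lost.\<close>

lemma block_labelling:
  assumes "finite S" and "finite V" and "\<And>K. K \<in> S \<Longrightarrow> K \<subseteq> V"
  shows "\<exists>p :: 'a \<Rightarrow> 'a. (\<forall>K\<in>S. \<forall>x\<in>K. \<forall>y\<in>K. p x = p y) \<and>
    real (card V) \<le> real (card (p ` V)) + (\<Sum>z\<in>block_pairs S. 1 / real (max_block S z))"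
  using assms(1,3)
\<comment> \<open>The negated size makes the inserted block the smallest one, so blocks arrive in
  decreasing order.\<close>
proof (induction S rule: finite_ranking_induct[where f = "\<lambda>K. - int (card K)"])
  case empty
  show ?case by (intro exI[of _ id]) (simp add: block_pairs_def)
next
  case (insert K S)
  have "L \<subseteq> V" if "L \<in> S" for L using insert.prems that by simp
  from insert.IH[OF this] obtain p :: "'a \<Rightarrow> 'a" where const: "\<forall>L\<in>S. \<forall>x\<in>L. \<forall>y\<in>L. p x = p y"
    and bound: "real (card V) \<le> real (card (p ` V)) + (\<Sum>z\<in>block_pairs S. 1 / real (max_block S z))"
    by blast
  have KV: "K \<subseteq> V" using insert.prems by simp
  then have finK: "finite K" using assms(2) finite_subset by blast
  obtain q :: "'a \<Rightarrow> 'a" where q: "\<And>x y. x \<in> K \<Longrightarrow> y \<in> K \<Longrightarrow> q x = q y" "\<And>x y. p x = p y \<Longrightarrow> q x = q y"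
    and cq: "card (p ` V) \<le> card (q ` V) + (card (p ` K) - 1)"
    using merge_labels[OF assms(2) KV, of p] by blast
  \<comment> \<open>Pairs of \<open>K\<close> separated by \<open>p\<close> lie in no earlier block,
    since \<open>p\<close> is constant on those; hence each has weight
    \<open>1 / card K\<close>.\<close>
  define D where "D = {(x, y). x \<in> K \<and> y \<in> K \<and> p x \<noteq> p y}"
  have disj: "block_pairs S \<inter> D = {}"
    using const by (auto simp: block_pairs_def D_def)
  have finB: "finite (block_pairs (insert K S))"
  proof (rule finite_subset)
    show "block_pairs (insert K S) \<subseteq> V \<times> V"
      using insert.prems by (rule block_pairs_subset)
  qed (use assms(2) in simp)
  have sub: "block_pairs S \<union> D \<subseteq> block_pairs (insert K S)"
    by (auto simp: block_pairs_def D_def)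
  have fins: "finite (block_pairs S)" "finite D"
    using sub finB finite_subset by blast+
  have old: "(\<Sum>z\<in>block_pairs S. 1 / real (max_block (insert K S) z))
      = (\<Sum>z\<in>block_pairs S. 1 / real (max_block S z))"
    using insert.hyps by (intro sum.cong refl) (subst max_block_insert_old, auto)
  have "max_block (insert K S) z = card K" if "z \<in> D" for z
    using that disj by (intro max_block_insert_new) (auto simp: D_def)
  then have new: "(\<Sum>z\<in>D. 1 / real (max_block (insert K S) z)) = real (card D) / real (card K)"
    by simp
  have "real (card (p ` K) - 1) \<le> real (card D) / real (card K)"
  \<comment> \<open>The empty set is a clique, so this case occurs; truncated subtraction and
    division by zero make both sides 0.\<close>
  proof (cases "K = {}")
    case False
    then have "card K > 0" using finK by (simp add: card_gt_0_iff)
    moreover have "real (card K * (card (p ` K) - 1)) \<le> real (card D)"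
      unfolding D_def of_nat_le_iff by (rule card_separated_pairs[OF finK])
    ultimately show ?thesis by (simp add: field_simps)
  qed simp
  then have "real (card V) \<le> real (card (q ` V)) +
      (\<Sum>z\<in>block_pairs S \<union> D. 1 / real (max_block (insert K S) z))"
    using bound cq fins disj old new by (simp add: sum.union_disjoint)
  \<comment> \<open>New pairs of \<open>K\<close> with equal \<open>p\<close>-labels may also
    appear; their weights are nonnegative.\<close>
  also have "\<dots> \<le> real (card (q ` V)) +
      (\<Sum>z\<in>block_pairs (insert K S). 1 / real (max_block (insert K S) z))"
    using finB sub by (intro add_left_mono sum_mono2) auto
  finally have "real (card V) \<le> real (card (q ` V)) +
      (\<Sum>z\<in>block_pairs (insert K S). 1 / real (max_block (insert K S) z))" .
  moreover have "q x = q y" if "L \<in> insert K S" "x \<in> L" "y \<in> L" for L x y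
  proof (cases "L = K")
    case True
    then show ?thesis using that by (intro q(1)) simp_all
  next
    case False
    then have "L \<in> S" using that(1) by simp
    then show ?thesis using const that(2,3) by (intro q(2)) blast
  qed
  ultimately show ?case by (intro exI[of _ q] conjI ballI)
qed

section \<open>Edges, arcs and clique orders\<close>

context graph
begin

lemma finite_arcs_ends: "finite (arcs_ends G)"
  by (simp add: arcs_ends_def)

text \<open>By symmetry and absence of loops, the fibre over an edge consists of exactly two
  opposite pairs.\<close>

lemma sum_arcs_ends_eq_edges:
  fixes g :: "'a set \<Rightarrow> real"
  shows "(\<Sum>z\<in>arcs_ends G. g {fst z, snd z}) = 2 * (\<Sum>e\<in>edges G. g e)"
proof -
  let ?h = "\<lambda>z. {fst z, snd z}"
  have im: "?h ` arcs_ends G = edges G" by (force simp: edges_def)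
  have fiber: "sum (\<lambda>z. g (?h z)) {z \<in> arcs_ends G. ?h z = e} = 2 * g e" if "e \<in> edges G" for e
  proof -
    obtain u v where e: "e = {u, v}" "u \<rightarrow> v" using \<open>e \<in> edges G\<close> by (auto simp: edges_def)
    have "u \<noteq> v" using e adj_not_same by blast
    moreover have "v \<rightarrow> u" using e graph_symmetric by blast
    ultimately have "{z \<in> arcs_ends G. ?h z = e} = {(u, v), (v, u)}"
      using e by (auto simp: doubleton_eq_iff)
    then show ?thesis using \<open>u \<noteq> v\<close> e by (simp add: insert_commute)
  qed
  have "(\<Sum>z\<in>arcs_ends G. g (?h z)) = (\<Sum>e\<in>?h ` arcs_ends G. sum (\<lambda>z. g (?h z)) {z \<in> arcs_ends G. ?h z = e})"
    using finite_arcs_ends by (rule sum.image_gen)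
  also have "\<dots> = 2 * (\<Sum>e\<in>edges G. g e)"
    using sum.cong[OF refl fiber] by (simp only: im sum_distrib_left)
  finally show ?thesis .
qed

lemma clique_edge: "u \<rightarrow> v \<Longrightarrow> clique G {u, v}"
  using adj_in_verts graph_symmetric by (auto simp: clique_def)

lemma finite_cliques: "finite {K. clique G K}"
  by (rule finite_subset[of _ "Pow (verts G)"]) (auto simp: clique_def)

text \<open>The edge itself is a clique, and in a largest clique containing it all vertices other
  than \<open>u\<close> are neighbours of \<open>u\<close>.\<close>

lemma cl_bounds:
  assumes "u \<rightarrow> v"
  shows "2 \<le> cl G {u, v}" and "cl G {u, v} - 1 \<le> card {w. u \<rightarrow> w}"
proof -
  let ?A = "{card K | K. clique G K \<and> {u, v} \<subseteq> K}"
  have fin: "finite ?A" using finite_cliques by simp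
  have "card {u, v} \<in> ?A" using clique_edge[OF assms] by blast
  moreover have "u \<noteq> v" using assms adj_not_same by blast
  moreover from this have "card {u, v} = 2" by simp
  ultimately have two: "2 \<in> ?A" by (simp only:)
  then show "2 \<le> cl G {u, v}" unfolding cl_def using fin by (intro Max_ge)
  have "cl G {u, v} \<in> ?A" unfolding cl_def using fin two by (intro Max_in) auto
  then obtain K where K: "cl G {u, v} = card K" "clique G K" "u \<in> K" by auto
  have finN: "finite {w. u \<rightarrow> w}"
    by (rule finite_subset[of _ "verts G"]) (auto dest: adj_in_verts)
  have "card K - 1 = card (K - {u})" using K(3) by simp
  also have "\<dots> \<le> card {w. u \<rightarrow> w}"
    using K by (intro card_mono finN) (auto simp: clique_def)
  finally show "cl G {u, v} - 1 \<le> card {w. u \<rightarrow> w}" using K(1) by simp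
qed

text \<open>Each of the neighbours of \<open>u\<close> contributes at least the reciprocal of the
  degree, which is positive as \<open>u\<close> is not isolated.\<close>

lemma vertex_sum_ge_one:
  assumes "u \<in> verts G" and "\<not> isolated G u"
  shows "1 \<le> (\<Sum>v | u \<rightarrow> v. 1 / (real (cl G {u, v}) - 1))"
proof -
  let ?N = "{v. u \<rightarrow> v}"
  have "finite ?N" by (rule finite_subset[of _ "verts G"]) (auto dest: adj_in_verts)
  moreover have "?N \<noteq> {}"
    using assms graph_symmetric by (fastforce simp: isolated_def edges_def)
  ultimately have pos: "card ?N > 0" by (simp add: card_gt_0_iff)
  have "1 / real (card ?N) \<le> 1 / (real (cl G {u, v}) - 1)" if "v \<in> ?N" for v
    using cl_bounds[of u v] that pos by (intro divide_left_mono mult_pos_pos) auto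
  then have "(\<Sum>v\<in>?N. 1 / real (card ?N)) \<le> (\<Sum>v\<in>?N. 1 / (real (cl G {u, v}) - 1))"
    by (rule sum_mono)
  then show ?thesis using pos by simp
qed

section \<open>Labels and connected components\<close>

text \<open>A connected supergraph inside \<open>G\<close> gains no vertices, since by symmetry its
  paths give reachability in \<open>G\<close>, and no arcs, since the subgraph is induced.\<close>

lemma reachable_set_max_connected:
  assumes "v \<in> verts G"
  shows "max_subgraph connected (G \<restriction> {w. v \<rightarrow>\<^sup>* w})"
proof -
  let ?H = "G \<restriction> {w. v \<rightarrow>\<^sup>* w}"
  have "?H \<in> sccs" using assms by (rule induce_reachable_is_in_sccs)
  then have ind: "induced_subgraph ?H G" and sc: "strongly_connected ?H"
    by (auto simp: sccs_def)
  interpret H: wf_digraph ?H by (rule wellformed_induce_subgraph)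
  have con: "connected ?H"
    using sc H.reachable_mk_symmetricI by (auto simp: connected_def strongly_connected_def)
  show ?thesis
  proof (rule max_subgraphI)
    fix H' assume H': "?H \<noteq> H'" "subgraph ?H H'" "subgraph H' G"
    show "\<not> connected H'"
    proof
      assume "connected H'"
      then have "w \<in> {w. v \<rightarrow>\<^sup>* w}" if "w \<in> verts H'" for w
      proof -
        have "v \<in> verts H'" using H'(2) assms by (auto simp: subgraph_def)
        then have "v \<rightarrow>\<^sup>*\<^bsub>mk_symmetric H'\<^esub> w"
          using \<open>connected H'\<close> that by (auto simp: connected_def strongly_connected_def)
        then have "v \<rightarrow>\<^sup>*\<^bsub>mk_symmetric G\<^esub> w"
          using pre_digraph.reachable_mono[OF _ subgraph_mk_symmetric[OF H'(3)]] by blast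
        then show ?thesis using reachable_mk_symmetric_eq[OF sym_arcs] by simp
      qed
      then have "verts H' = verts ?H" using H'(2) by (auto simp: subgraph_def)
      \<comment> \<open>An induced subgraph is maximal among the subgraphs with its vertex
        set.\<close>
      then show False
        using ind H' unfolding induced_subgraph_altdef2 max_subgraph_def by metis
    qed
  qed (use con ind in \<open>auto dest: induced_imp_subgraph\<close>)
qed

text \<open>A subgraph inherits \<open>tail\<close> and \<open>head\<close>, so its vertex and arc
  sets determine it. Finiteness matters because \<open>card\<close> of an infinite set of components
  would be 0.\<close>

lemma finite_subgraphs: "finite {H. subgraph H G}"
proof (rule finite_subset)
  show "{H. subgraph H G} \<subseteq> (\<lambda>(V, A). \<lparr>verts = V, arcs = A, tail = tail G, head = head G\<rparr>) `
      (Pow (verts G) \<times> Pow (arcs G))"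
  proof
    fix H assume "H \<in> {H. subgraph H G}"
    then show "H \<in> (\<lambda>(V, A). \<lparr>verts = V, arcs = A, tail = tail G, head = head G\<rparr>) `
        (Pow (verts G) \<times> Pow (arcs G))"
      by (intro image_eqI[of _ _ "(verts H, arcs H)"]) (auto simp: subgraph_def compatible_def)
  qed
qed simp

text \<open>Labels constant along arcs are constant on reachable sets, so every label can be read
  off a component at an arbitrarily chosen vertex.\<close>

lemma card_labels_le_num_components:
  assumes "\<And>u v. u \<rightarrow> v \<Longrightarrow> p u = p v"
  shows "card (p ` verts G) \<le> num_components G"
proof -
  let ?C = "{H. max_subgraph connected H}"
  have fin: "finite ?C"
    by (rule finite_subset[OF _ finite_subgraphs]) (auto dest: subgraphI_max_subgraph)
  have const: "p w = p v" if "v \<rightarrow>\<^sup>* w" for v w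
    using that by (induction rule: reachable_induct) (use assms in auto)
  have "p ` verts G \<subseteq> (\<lambda>H. p (SOME w. w \<in> verts H)) ` ?C"
  proof (rule image_subsetI)
    fix v assume v: "v \<in> verts G"
    have "v \<rightarrow>\<^sup>* (SOME w. w \<in> {w. v \<rightarrow>\<^sup>* w})"
      using v by (metis (mono_tags, lifting) mem_Collect_eq reachable_refl someI_ex)
    then have "p v = p (SOME w. w \<in> verts (G \<restriction> {w. v \<rightarrow>\<^sup>* w}))"
      using const by simp
    then show "p v \<in> (\<lambda>H. p (SOME w. w \<in> verts H)) ` ?C"
      using reachable_set_max_connected[OF v] by blast
  qed
  then have "card (p ` verts G) \<le> card ?C" using fin by (rule surj_card_le[rotated])
  then show ?thesis by (simp add: num_components_def)
qed

section \<open>The two inequalities\<close>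

lemma edge_sum_cl_minus_one:
  assumes "\<not> (\<exists>v. isolated G v)"
  shows "real (card (verts G)) / 2 \<le> (\<Sum>e\<in>edges G. 1 / (real (cl G e) - 1))"
proof -
  have "real (card (verts G)) \<le> (\<Sum>u\<in>verts G. \<Sum>v | u \<rightarrow> v. 1 / (real (cl G {u, v}) - 1))"
    using assms vertex_sum_ge_one sum_mono[of "verts G" "\<lambda>_. 1 :: real"] by simp
  also have "\<dots> = (\<Sum>z\<in>(SIGMA u:verts G. {v. u \<rightarrow> v}). 1 / (real (cl G {fst z, snd z}) - 1))"
    by (subst sum.Sigma)
      (auto intro!: sum.cong finite_subset[of "{v. _ \<rightarrow> v}" "verts G"] dest: adj_in_verts)
  \<comment> \<open>Vertex-neighbour pairs are the end pairs of arcs, which count each edge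
    twice.\<close>
  also have "(SIGMA u:verts G. {v. u \<rightarrow> v}) = arcs_ends G"
    by (auto dest: adj_in_verts)
  also have "(\<Sum>z\<in>arcs_ends G. 1 / (real (cl G {fst z, snd z}) - 1))
      = 2 * (\<Sum>e\<in>edges G. 1 / (real (cl G e) - 1))"
    by (rule sum_arcs_ends_eq_edges)
  finally show ?thesis by simp
qed

text \<open>\<open>block_labelling\<close> is applied to all cliques. Adjacent vertices form a
  clique, so the final labels are constant along arcs and number at most
  \<open>num_components G\<close>.\<close>

lemma edge_sum_cl:
  "(real (card (verts G)) - real (num_components G)) / 2 \<le> (\<Sum>e\<in>edges G. 1 / real (cl G e))"
proof -
  let ?S = "{K. clique G K}"
  have "K \<subseteq> verts G" if "K \<in> ?S" for K using that by (simp add: clique_def)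
  from block_labelling[OF finite_cliques finite_verts this]
  obtain p :: "'a \<Rightarrow> 'a" where const: "\<forall>K\<in>?S. \<forall>x\<in>K. \<forall>y\<in>K. p x = p y"
    and bound: "real (card (verts G)) \<le> real (card (p ` verts G))
      + (\<Sum>z\<in>block_pairs ?S. 1 / real (max_block ?S z))"
    by blast
  have "p u = p v" if "u \<rightarrow> v" for u v
    using const clique_edge[OF that] by auto
  then have "card (p ` verts G) \<le> num_components G" by (rule card_labels_le_num_components)
  moreover have "block_pairs ?S = arcs_ends G"
  proof (intro set_eqI iffI)
    fix z assume "z \<in> block_pairs ?S"
    then show "z \<in> arcs_ends G" by (auto simp: block_pairs_def clique_def)
  next
    fix z assume z: "z \<in> arcs_ends G"
    obtain u v where "z = (u, v)" by (cases z)
    moreover have "u \<noteq> v" using z calculation adj_not_same by blast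
    moreover have "clique G {u, v}" using z calculation(1) by (intro clique_edge) simp
    ultimately show "z \<in> block_pairs ?S" unfolding block_pairs_def by blast
  qed
  moreover have "max_block ?S z = cl G {fst z, snd z}" for z
    by (simp add: max_block_def cl_def)
  ultimately have "real (card (verts G)) - real (num_components G)
      \<le> (\<Sum>z\<in>arcs_ends G. 1 / real (cl G {fst z, snd z}))"
    using bound by simp
  also have "\<dots> = 2 * (\<Sum>e\<in>edges G. 1 / real (cl G e))"
    by (rule sum_arcs_ends_eq_edges)
  finally show ?thesis by simp
qed

end

theorem theorem1p5:
  fixes G :: "('a, 'b) pre_digraph" and n :: nat
  assumes "graph G"
    and "card (verts G) = n"
    and "n \<ge> 2"
    and "\<not> (\<exists>v. isolated G v)"
  shows "(\<Sum>e\<in>edges G. 1 / (real (cl G e) - 1)) \<ge> real n / 2 \<and>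
         (\<Sum>e\<in>edges G. 1 / real (cl G e)) \<ge> (real n - real (num_components G)) / 2"
  using graph.edge_sum_cl_minus_one[OF assms(1,4)] graph.edge_sum_cl[OF assms(1)] assms(2) by simp

end
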